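(* For all real numbers $a$ and all positive integers $k$, $$ s(a+1,k)=s(a,k-1)-a\,s(a,k). $$
   Context: For a real number $a$, the lower factorial is $(y)_a=\dfrac{\Gamma(y+1)}{\Gamma(y-a+1)}$, where $\Gamma$ is the Gamma function (and $1/\Gamma$ is taken as an entire function), regarded as a Taylor series in $y$ at $y=0$. For a real number $a$ and a nonnegative integer $k$, the Stirling number of the first kind $s(a,k)$ of degree $a$ and order $k$ is the coefficient of $y^k$ in the Taylor expansion of $(y)_a$ at $y=0$, i.e. $(y)_a=\sum_{k\ge 0}s(a,k)y^k$. *)

theory Defs
  imports "HOL-Complex_Analysis.Complex_Analysis"
begin

text \<open>
  The reciprocal \<open>1/\<Gamma>(y - a + 1)\<close> is written with the total function \<open>rGamma\<close>, which
  vanishes at the poles of \<open>\<Gamma>\<close>. The factor \<open>\<Gamma>(y + 1)\<close> has no pole near \<open>y = 0\<close>.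
\<close>

definition lower_factorial :: "real \<Rightarrow> real \<Rightarrow> real" where
  "lower_factorial a y = Gamma (y + 1) * rGamma (y - a + 1)"

definition stirling1 :: "real \<Rightarrow> nat \<Rightarrow> real" where
  "stirling1 a k = (deriv ^^ k) (lower_factorial a) 0 / fact k"

lemma fps_nth_fps_expansion_real:
  fixes f :: "real \<Rightarrow> real"
  assumes "f has_fps_expansion F"
  shows "fps_nth F n = (deriv ^^ n) f 0 / fact n"
  using assms
proof (induction n arbitrary: f F)
  case 0
  have "eval_fps F 0 = f 0"
    using 0 eventually_nhds_x_imp_x[of "\<lambda>z. eval_fps F z = f z" 0]
    by (simp add: has_fps_expansion_def)
  thus ?case
    by (simp add: eval_fps_at_0)
next
  case (Suc n)
  have "fps_nth (fps_deriv F) n = (deriv ^^ n) (deriv f) 0 / fact n"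
    by (intro Suc.IH has_fps_expansion_deriv Suc.prems)
  thus ?case
    by (simp add: funpow_Suc_right field_simps del: funpow.simps of_nat_Suc)
qed

text \<open>
  The Taylor series at \<open>0\<close> has positive radius of convergence and represents
  \<open>lower_factorial a\<close> near \<open>0\<close>, so the numbers \<open>stirling1 a k\<close> are its coefficients.
\<close>

lemma lower_factorial_has_fps_expansion:
  "lower_factorial a has_fps_expansion Abs_fps (stirling1 a)"
proof -
  define f where "f = (\<lambda>z::complex. Gamma (z + 1) * rGamma (z - of_real a + 1))"
  have "f analytic_on {0}"
    unfolding f_def by (intro analytic_intros) auto
  then obtain F where F: "f has_fps_expansion F"
    using analytic_at_imp_has_fps_expansion_0 by blast
  define G where "G = Abs_fps (\<lambda>n. Re (fps_nth F n))"
  have sums_G: "(\<lambda>n. fps_nth G n * y ^ n) sums Re (eval_fps F (of_real y))"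
    if "ereal (norm y) < fps_conv_radius F" for y :: real
  proof -
    have "(\<lambda>n. fps_nth F n * complex_of_real y ^ n) sums eval_fps F (of_real y)"
      unfolding eval_fps_def
      by (rule summable_sums, rule summable_fps) (use that in simp)
    hence "(\<lambda>n. Re (fps_nth F n * complex_of_real y ^ n)) sums Re (eval_fps F (of_real y))"
      by (rule sums_Re)
    moreover have "Re (fps_nth F n * complex_of_real y ^ n) = fps_nth G n * y ^ n" for n
      by (simp add: G_def flip: of_real_power)
    ultimately show ?thesis
      by (simp only:)
  qed
  have rad: "fps_conv_radius F \<le> fps_conv_radius G"
    unfolding fps_conv_radius_def[of G]
  proof (rule conv_radius_geI_ex')
    fix r :: real
    assume "0 < r" "ereal r < fps_conv_radius F"
    thus "summable (\<lambda>n. fps_nth G n * of_real r ^ n)"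
      using sums_G[of r] by (simp add: sums_iff)
  qed
  have pos: "fps_conv_radius F > 0"
    using F by (simp add: has_fps_expansion_def)
  have ev: "eventually (\<lambda>z. eval_fps F z = f z) (nhds 0)"
    using F by (simp add: has_fps_expansion_def)
  have lim: "filterlim complex_of_real (nhds 0) (nhds 0)"
    using tendsto_of_real[OF filterlim_ident, of "0::real"] by simp
  have ev1: "eventually (\<lambda>y. eval_fps F (complex_of_real y) = f (of_real y)) (nhds 0)"
    using filterlim_iff[THEN iffD1, OF lim] ev by blast
  have ev2: "eventually (\<lambda>y. y \<in> eball (0::real) (fps_conv_radius F)) (nhds 0)"
    by (rule eventually_nhds_in_open) (use pos in \<open>auto simp: zero_ereal_def\<close>)
  have "eventually (\<lambda>y. eval_fps G y = lower_factorial a y) (nhds 0)"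
    using ev1 ev2
  proof eventually_elim
    case (elim y)
    have "(\<lambda>n. fps_nth G n * y ^ n) sums Re (f (of_real y))"
      using sums_G[of y] elim by simp
    moreover have "f (of_real y) = of_real (lower_factorial a y)"
      using Gamma_complex_of_real[of "y + 1"] rGamma_complex_of_real[of "y - a + 1"]
      by (simp add: f_def lower_factorial_def)
    ultimately show ?case
      by (simp add: eval_fps_def sums_iff)
  qed
  hence G: "lower_factorial a has_fps_expansion G"
    using pos rad by (auto simp: has_fps_expansion_def)
  moreover have "G = Abs_fps (stirling1 a)"
    by (rule fps_ext) (simp add: stirling1_def fps_nth_fps_expansion_real[OF G])
  ultimately show ?thesis by simp
qed

end

theory Submission
  imports Defs
begin

text \<open>The functional equation \<open>z * rGamma (z + 1) = rGamma z\<close> at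
  \<open>z = y - a\<close> gives \<open>(y)_{a+1} = (y - a) (y)_a\<close> for every real
  \<open>y\<close>, poles of Gamma included. Comparing coefficients of \<open>y^k\<close> in the
  Taylor series at 0 yields the recurrence.\<close>

lemma lower_factorial_add_one:
  "lower_factorial (a + 1) y = (y - a) * lower_factorial a y"
  using rGamma_plus1[of "y - a"] by (simp add: lower_factorial_def)

theorem theorem1p3:
  fixes a :: real and k :: nat
  assumes "k > 0"
  shows "stirling1 (a + 1) k = stirling1 a (k - 1) - a * stirling1 a k"
proof -
  let ?S = "Abs_fps (stirling1 a)"
  have "(\<lambda>y. (y - a) * lower_factorial a y) has_fps_expansion (fps_X - fps_const a) * ?S"
    by (intro fps_expansion_intros lower_factorial_has_fps_expansion)
  also have "(\<lambda>y. (y - a) * lower_factorial a y) = lower_factorial (a + 1)"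
    by (simp add: lower_factorial_add_one fun_eq_iff)
  finally have "stirling1 (a + 1) k = fps_nth ((fps_X - fps_const a) * ?S) k"
    by (simp only: stirling1_def[of "a + 1"] fps_nth_fps_expansion_real)
  \<comment> \<open>\<open>fps_X\<close> shifts coefficients by one; \<open>k > 0\<close> excludes
    the constant term, where the shift gives 0 but \<open>k - 1\<close> truncates to 0.\<close>
  also have "\<dots> = stirling1 a (k - 1) - a * stirling1 a k"
    using assms by (simp add: left_diff_distrib)
  finally show ?thesis .
qed

end
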